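(* Let $\mathscr{H}$ be a complex Hilbert space and let $U$ be a unitary operator on $\mathscr{H}$ such that any one of the following conditions holds: (i) $U^{n_0}=I$ for some positive integer $n_0$; (ii) $U^n\to I$ as $n\to\infty$ in the strong operator topology. Then for any bounded self-adjoint operators $A,B$ on $\mathscr{H}$, the inequalities $B\leq A\leq U^*BU$ imply $B=A=U^*BU$.
   Context: For bounded self-adjoint operators $A,B$ on a complex Hilbert space $\mathscr{H}$, $A\leq B$ means that $B-A$ is positive, i.e. $\langle (B-A)x,x\rangle\geq 0$ for all $x\in\mathscr{H}$. $I$ denotes the identity operator. *)

theory Defs
  imports "HOL-Analysis.Analysis"
begin

section \<open>Complex Hilbert spaces\<close>

text \<open>
  The real structure inherited from \<^class>\<open>real_inner\<close> is determined by the complex one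
  through \<open>scaleR_scaleC\<close> and \<open>inner_eq_Re_cinner\<close>; positive definiteness of \<open>cinner\<close> and
  \<open>norm x = sqrt (Re (cinner x x))\<close> follow.  Conversely every complex Hilbert space carries
  this real structure.  The inner product is linear in its first argument.
\<close>

class complex_inner = real_inner +
  fixes scaleC :: "complex \<Rightarrow> 'a \<Rightarrow> 'a" (infixr \<open>*\<^sub>C\<close> 75)
    and cinner :: "'a \<Rightarrow> 'a \<Rightarrow> complex"
  assumes scaleC_add_right: "a *\<^sub>C (x + y) = a *\<^sub>C x + a *\<^sub>C y"
    and scaleC_add_left: "(a + b) *\<^sub>C x = a *\<^sub>C x + b *\<^sub>C x"
    and scaleC_scaleC: "a *\<^sub>C (b *\<^sub>C x) = (a * b) *\<^sub>C x"
    and scaleC_one: "1 *\<^sub>C x = x"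
    and scaleR_scaleC: "scaleR r x = complex_of_real r *\<^sub>C x"
    and cinner_commute: "cinner x y = cnj (cinner y x)"
    and cinner_add_left: "cinner (x + y) z = cinner x z + cinner y z"
    and cinner_scaleC_left: "cinner (a *\<^sub>C x) y = a * cinner x y"
    and inner_eq_Re_cinner: "inner x y = Re (cinner x y)"

class complex_hilbert_space = complex_inner + complete_space

instantiation complex :: complex_hilbert_space
begin

definition scaleC_complex :: "complex \<Rightarrow> complex \<Rightarrow> complex"
  where "scaleC_complex a x = a * x"

definition cinner_complex :: "complex \<Rightarrow> complex \<Rightarrow> complex"
  where "cinner_complex x y = x * cnj y"

instance
  by standard (auto simp: scaleC_complex_def cinner_complex_def algebra_simps
      scaleR_conv_of_real inner_complex_def)

end

section \<open>Bounded operators\<close>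

text \<open>
  \<^typ>\<open>'a \<Rightarrow>\<^sub>L 'a\<close> is the type of bounded real-linear maps; a bounded operator on a complex
  Hilbert space is such a map that is moreover complex-homogeneous.
\<close>

definition bounded_op :: "('a::complex_hilbert_space \<Rightarrow>\<^sub>L 'a) \<Rightarrow> bool"
  where "bounded_op T \<longleftrightarrow> (\<forall>a x. T (a *\<^sub>C x) = a *\<^sub>C T x)"

text \<open>Well defined on bounded operators, see \<open>cadjoint_works\<close> and \<open>cadjoint_unique\<close> below.\<close>

definition cadjoint :: "('a::complex_hilbert_space \<Rightarrow>\<^sub>L 'a) \<Rightarrow> ('a \<Rightarrow>\<^sub>L 'a)"
  where "cadjoint T = (THE S. \<forall>x y. cinner (blinfun_apply S x) y = cinner x (T y))"

definition self_adjoint_op :: "('a::complex_hilbert_space \<Rightarrow>\<^sub>L 'a) \<Rightarrow> bool"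
  where "self_adjoint_op T \<longleftrightarrow> bounded_op T \<and> cadjoint T = T"

definition unitary_op :: "('a::complex_hilbert_space \<Rightarrow>\<^sub>L 'a) \<Rightarrow> bool"
  where "unitary_op U \<longleftrightarrow> bounded_op U \<and>
    cadjoint U o\<^sub>L U = id_blinfun \<and> U o\<^sub>L cadjoint U = id_blinfun"

definition positive_op :: "('a::complex_hilbert_space \<Rightarrow>\<^sub>L 'a) \<Rightarrow> bool"
  where "positive_op T \<longleftrightarrow> (\<forall>x. cinner (T x) x \<in> \<real>\<^sub>\<ge>\<^sub>0)"

definition op_le :: "('a::complex_hilbert_space \<Rightarrow>\<^sub>L 'a) \<Rightarrow> ('a \<Rightarrow>\<^sub>L 'a) \<Rightarrow> bool"
    (infix \<open>\<le>\<^sub>o\<^sub>p\<close> 50)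
  where "A \<le>\<^sub>o\<^sub>p B \<longleftrightarrow> positive_op (B - A)"

definition op_power :: "('a::complex_hilbert_space \<Rightarrow>\<^sub>L 'a) \<Rightarrow> nat \<Rightarrow> ('a \<Rightarrow>\<^sub>L 'a)"
  where "op_power T n = (((o\<^sub>L) T) ^^ n) id_blinfun"

section \<open>Existence and uniqueness of the adjoint\<close>

lemma riesz_real:
  fixes f :: "'a::{real_inner,complete_space} \<Rightarrow> real"
  assumes "bounded_linear f"
  shows "\<exists>z. \<forall>x. f x = inner z x"
proof -
  interpret f: bounded_linear f by fact
  obtain K where K: "\<And>x. norm (f x) \<le> norm x * K" using f.bounded by blast
  define J where "J x = inner x x / 2 - f x" for x
  have lower: "- (K\<^sup>2 / 2) \<le> J x" for x
  proof -
    have "0 \<le> (norm x - K)\<^sup>2" by simp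
    hence "norm x * K \<le> (norm x)\<^sup>2 / 2 + K\<^sup>2 / 2"
      by (simp add: power2_eq_square algebra_simps)
    moreover have "f x \<le> norm x * K" using K[of x] by simp
    ultimately show ?thesis by (simp add: J_def dot_square_norm)
  qed
  have bdd: "bdd_below (range J)" using lower by (auto intro!: bdd_belowI)
  define m where "m = Inf (range J)"
  have m_le: "m \<le> J x" for x unfolding m_def using bdd by (simp add: cInf_lower)
  have "\<exists>x. J x < m + inverse (Suc n)" for n
  proof -
    have "Inf (range J) < m + inverse (Suc n)" unfolding m_def by simp
    from cInf_lessD[OF _ this] show ?thesis by auto
  qed
  then obtain X where X: "\<And>n. J (X n) < m + inverse (Suc n)" by metis
  have para: "J x + J y - 2 * J ((x + y) /\<^sub>R 2) = (norm (x - y))\<^sup>2 / 4" for x y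
    by (simp add: J_def f.scaleR f.add power2_norm_eq_inner inner_add_left inner_add_right
        inner_diff_left inner_diff_right inner_commute[of y x] field_simps)
  have "Cauchy X"
  proof (rule CauchyI)
    fix e :: real assume "0 < e"
    then obtain N where N: "inverse (Suc N) < e\<^sup>2 / 8"
      using reals_Archimedean[of "e\<^sup>2 / 8"] by auto
    have "norm (X i - X j) < e" if "N \<le> i" "N \<le> j" for i j
    proof -
      have i: "inverse (Suc i) \<le> inverse (Suc N)" and j: "inverse (Suc j) \<le> inverse (Suc N)"
        using that by (auto intro!: le_imp_inverse_le)
      have "(norm (X i - X j))\<^sup>2 / 4 < 2 * inverse (Suc N)"
        using para[of "X i" "X j"] X[of i] X[of j] m_le[of "(X i + X j) /\<^sub>R 2"] i j by linarith
      hence "(norm (X i - X j))\<^sup>2 < e\<^sup>2" using N by linarith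
      thus ?thesis using \<open>0 < e\<close> by (simp add: power2_less_imp_less)
    qed
    thus "\<exists>M. \<forall>i\<ge>M. \<forall>j\<ge>M. norm (X i - X j) < e" by blast
  qed
  then obtain z where z: "X \<longlonglongrightarrow> z" using Cauchy_convergent convergent_def by blast
  have "(\<lambda>n. J (X n)) \<longlonglongrightarrow> J z" unfolding J_def by (intro tendsto_intros z f.tendsto) simp
  moreover have "(\<lambda>n. m + inverse (real (Suc n))) \<longlonglongrightarrow> m + 0"
    by (intro tendsto_add tendsto_const LIMSEQ_inverse_real_of_nat)
  ultimately have "J z \<le> m + 0"
    by (rule LIMSEQ_le) (use X less_imp_le in blast)
  hence min: "J z \<le> J x" for x using m_le[of x] by simp
  have "f x = inner z x" for x
  proof (rule ccontr)
    define d where "d = inner z x - f x"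
    assume "f x \<noteq> inner z x"
    hence d: "d \<noteq> 0" by (simp add: d_def)
    define q where "q = inner x x + 1"
    have q: "q > 0" by (simp add: q_def add_nonneg_pos)
    define t where "t = - d / q"
    have "J (z + t *\<^sub>R x) - J z = t * d + t\<^sup>2 * inner x x / 2"
      by (simp add: J_def d_def f.add f.scaleR inner_add_left inner_add_right
          inner_commute[of x z] power2_eq_square field_simps)
    also have "\<dots> \<le> t * d + t\<^sup>2 * q / 2" by (simp add: q_def algebra_simps)
    also have "\<dots> = - (d\<^sup>2 / (2 * q))"
      using q by (simp add: t_def power2_eq_square field_simps)
    also have "\<dots> < 0" using d q by simp
    finally show False using min[of "z + t *\<^sub>R x"] by simp
  qed
  thus ?thesis by blast
qed

lemma cinner_Re_inner: "Re (cinner x y) = inner x y"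
  by (simp add: inner_eq_Re_cinner)

lemma cinner_Im_inner: "Im (cinner x y) = inner (- \<i> *\<^sub>C x) y"
  by (simp add: inner_eq_Re_cinner cinner_scaleC_left)

lemma cinner_scaleC_right: "cinner x (a *\<^sub>C y) = cnj a * cinner x y"
  using cinner_commute[of x "a *\<^sub>C y"] cinner_commute[of x y]
  by (simp add: cinner_scaleC_left)

lemma cadjoint_exists:
  fixes T :: "'a::complex_hilbert_space \<Rightarrow>\<^sub>L 'a"
  assumes "bounded_op T"
  shows "\<exists>S :: 'a \<Rightarrow>\<^sub>L 'a. \<forall>x y. cinner (S x) y = cinner x (T y)"
proof -
  have "\<exists>z. \<forall>y. inner x (T y) = inner z y" for x
    by (rule riesz_real)
      (intro bounded_linear_compose[OF bounded_linear_inner_right blinfun.bounded_linear_right])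
  then obtain g where g: "\<And>x y. inner x (T y) = inner (g x) y" by metis
  have "bounded_linear g"
  proof (rule bounded_linear_intro)
    show "g (x + y) = g x + g y" for x y
      by (rule vector_eq_rdot[THEN iffD1]) (simp add: g[symmetric] inner_add_left)
    show "g (r *\<^sub>R x) = r *\<^sub>R g x" for r x
      by (rule vector_eq_rdot[THEN iffD1]) (simp add: g[symmetric])
    show "norm (g x) \<le> norm x * norm T" for x
    proof (cases "g x = 0")
      case False
      have "(norm (g x))\<^sup>2 = inner x (T (g x))" by (simp add: g power2_norm_eq_inner)
      also have "\<dots> \<le> norm x * norm (T (g x))" by (rule norm_cauchy_schwarz)
      also have "\<dots> \<le> norm x * (norm T * norm (g x))"
        by (intro mult_left_mono norm_blinfun) simp
      finally show ?thesis using False by (simp add: power2_eq_square)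
    qed simp
  qed
  then have S: "blinfun_apply (Blinfun g) = g" by (rule bounded_linear_Blinfun_apply)
  have "cinner (g x) y = cinner x (T y)" for x y
  proof (rule complex_eqI)
    show "Re (cinner (g x) y) = Re (cinner x (T y))" by (simp add: cinner_Re_inner g)
    have "Im (cinner (g x) y) = Re (cinner (g x) (\<i> *\<^sub>C y))"
      by (simp add: cinner_scaleC_right)
    also have "\<dots> = Re (cinner x (T (\<i> *\<^sub>C y)))" by (simp add: cinner_Re_inner g)
    also have "\<dots> = Im (cinner x (T y))"
      using assms by (simp add: bounded_op_def cinner_scaleC_right)
    finally show "Im (cinner (g x) y) = Im (cinner x (T y))" .
  qed
  with S show ?thesis by metis
qed

lemma adjoint_unique_aux:
  fixes T S S' :: "'a::complex_hilbert_space \<Rightarrow>\<^sub>L 'a"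
  assumes "\<forall>x y. cinner (S x) y = cinner x (T y)" "\<forall>x y. cinner (S' x) y = cinner x (T y)"
  shows "S = S'"
proof (rule blinfun_eqI)
  fix x
  show "S x = S' x"
    by (rule vector_eq_rdot[THEN iffD1]) (simp add: inner_eq_Re_cinner assms)
qed

lemma cadjoint_works:
  fixes T :: "'a::complex_hilbert_space \<Rightarrow>\<^sub>L 'a"
  assumes "bounded_op T"
  shows "cinner (cadjoint T x) y = cinner x (T y)"
proof -
  have "\<exists>!S. \<forall>x y. cinner (blinfun_apply S x) y = cinner x (T y)"
    using cadjoint_exists[OF assms] adjoint_unique_aux by blast
  from theI'[OF this] show ?thesis unfolding cadjoint_def by blast
qed

lemma cadjoint_unique:
  fixes S T :: "'a::complex_hilbert_space \<Rightarrow>\<^sub>L 'a"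
  assumes "\<And>x y. cinner (blinfun_apply S x) y = cinner x (T y)"
  shows "cadjoint T = S"
  unfolding cadjoint_def using assms by (intro the_equality) (auto intro: adjoint_unique_aux)

end

theory Submission
  imports Defs
begin

text \<open>
  For fixed \<open>x\<close>, the sequence \<open>\<langle>B U\<^sup>n x, U\<^sup>n x\<rangle>\<close> is nondecreasing, because
  \<open>\<langle>B x, x\<rangle> \<le> \<langle>A x, x\<rangle> \<le> \<langle>B U x, U x\<rangle>\<close> for all \<open>x\<close>. Either condition on \<open>U\<close> makes it return,
  exactly or in the limit, to its initial value, so it is constant and \<open>B\<close>, \<open>A\<close>, \<open>U\<^sup>* B U\<close> have
  the same quadratic form. A symmetric operator is determined by its quadratic form.
\<close>

text \<open>Polarization: symmetry makes the two cross terms in the form at \<open>x + y\<close>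
  equal, so the form determines \<open>inner (S x) y\<close>. For the real inner product symmetry is
  essential, as a skew map has zero form.\<close>

lemma symmetric_blinfun_eqI:
  fixes S T :: "'a::real_inner \<Rightarrow>\<^sub>L 'a"
  assumes S: "\<And>x y. inner (S x) y = inner x (S y)"
    and T: "\<And>x y. inner (T x) y = inner x (T y)"
    and eq: "\<And>x. inner (S x) x = inner (T x) x"
  shows "S = T"
proof (rule blinfun_eqI)
  fix x
  show "S x = T x"
  proof (rule vector_eq_rdot[THEN iffD1], intro allI)
    fix y
    have "2 * inner (S x) y = inner (S (x + y)) (x + y) - inner (S x) x - inner (S y) y"
      by (simp add: S[of y x] inner_commute[of y "S x"] blinfun.add_right inner_add_left inner_add_right)
    also have "\<dots> = inner (T (x + y)) (x + y) - inner (T x) x - inner (T y) y"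
      by (simp add: eq)
    also have "\<dots> = 2 * inner (T x) y"
      by (simp add: T[of y x] inner_commute[of y "T x"] blinfun.add_right inner_add_left inner_add_right)
    finally show "inner (S x) y = inner (T x) y"
      by simp
  qed
qed

lemma inner_cadjoint_left:
  assumes "bounded_op T"
  shows "inner (cadjoint T x) y = inner x (T y)"
  by (simp add: inner_eq_Re_cinner cadjoint_works[OF assms])

lemma self_adjoint_op_inner:
  assumes "self_adjoint_op T"
  shows "inner (T x) y = inner x (T y)"
  using assms inner_cadjoint_left[of T x y] by (simp add: self_adjoint_op_def)

lemma op_le_inner:
  assumes "A \<le>\<^sub>o\<^sub>p B"
  shows "inner (A x) x \<le> inner (B x) x"
proof -
  have "0 \<le> inner ((B - A) x) x"
    using assms by (simp add: op_le_def positive_op_def inner_eq_Re_cinner complex_nonneg_Reals_iff)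
  then show ?thesis
    by (simp add: blinfun.diff_left inner_diff_left)
qed

lemma op_power_Suc_apply: "op_power T (Suc n) x = T (op_power T n x)"
  by (simp add: op_power_def)

theorem theorem2p5:
  fixes U A B :: "'h::complex_hilbert_space \<Rightarrow>\<^sub>L 'h"
  assumes "unitary_op U"
    and "(\<exists>n\<^sub>0>0. op_power U n\<^sub>0 = id_blinfun) \<or>
         limitin strong_operator_topology (\<lambda>n. op_power U n) id_blinfun sequentially"
    and "self_adjoint_op A" and "self_adjoint_op B"
    and "B \<le>\<^sub>o\<^sub>p A" and "A \<le>\<^sub>o\<^sub>p cadjoint U o\<^sub>L B o\<^sub>L U"
  shows "B = A \<and> A = cadjoint U o\<^sub>L B o\<^sub>L U"
proof -
  let ?C = "cadjoint U o\<^sub>L B o\<^sub>L U"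
  define q where "q x = inner (B x) x" for x
  have "bounded_op U"
    using assms(1) by (simp add: unitary_op_def)
  note adj = inner_cadjoint_left[OF this]
  have A: "inner (A x) y = inner x (A y)" and B: "inner (B x) y = inner x (B y)" for x y
    using assms(3,4) by (simp_all add: self_adjoint_op_inner)
  have C: "inner (?C x) y = inner x (?C y)" for x y
    using adj[of "B (U x)" y] adj[of "B (U y)" x] B[of "U x" "U y"]
    by (simp add: inner_commute)
  have C_form: "inner (?C x) x = q (U x)" for x
    by (simp add: adj q_def)
  have BA: "q x \<le> inner (A x) x" and AC: "inner (A x) x \<le> q (U x)" for x
    using op_le_inner[OF assms(5), of x] op_le_inner[OF assms(6), of x] C_form[of x]
    by (simp_all add: q_def)
  have "incseq (\<lambda>n. q (op_power U n x))" for x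
    by (rule incseq_SucI) (use BA AC op_power_Suc_apply order_trans in metis)
  \<comment> \<open>The comparison starts at index 1, where the sequence equals
    \<open>q (U x)\<close>, the upper bound for the form of \<open>A\<close> at
    \<open>x\<close>.\<close>
  then have mono: "q (U x) \<le> q (op_power U n x)" if "n > 0" for n x
    using that incseqD[of "\<lambda>n. q (op_power U n x)" 1 n] by (simp add: op_power_def)
  \<comment> \<open>This closes the chain \<open>q x\<close> \<le> \<open>inner (A x) x\<close>
    \<le> \<open>q (U x)\<close> into a cycle.\<close>
  have "q (U x) \<le> q x" for x
    using assms(2)
  proof (elim disjE exE conjE)
    fix n assume "n > 0" "op_power U n = id_blinfun"
    then show ?thesis
      using mono[of n x] by simp
  next
    assume "limitin strong_operator_topology (\<lambda>n. op_power U n) id_blinfun sequentially"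
    \<comment> \<open>Evaluation at \<open>x\<close> is continuous in the strong operator topology,
      so it preserves the limit.\<close>
    then have "(\<lambda>n. op_power U n x) \<longlonglongrightarrow> x"
      using continuous_map_limit[OF strong_operator_topology_continuous_evaluation[of x],
          of "op_power U" id_blinfun sequentially]
      by (simp add: o_def)
    then have "(\<lambda>n. q (op_power U n x)) \<longlonglongrightarrow> q x"
      unfolding q_def by (intro tendsto_intros)
    then show ?thesis
      \<comment> \<open>The lower bound \<open>mono\<close> holds for positive \<open>n\<close>,
        hence the threshold 1.\<close>
      by (rule LIMSEQ_le_const) (use mono in \<open>auto intro!: exI[of _ 1]\<close>)
  qed
  then have BA_eq: "inner (B x) x = inner (A x) x" and AC_eq: "inner (A x) x = inner (?C x) x" for x
    using BA[of x] AC[of x] unfolding C_form q_def by (meson order_antisym order_trans)+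
  show ?thesis
    using symmetric_blinfun_eqI[OF B A BA_eq] symmetric_blinfun_eqI[OF A C AC_eq] by blast
qed

end
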